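(* Let $E=\{a,b,c,d,e,f,g,h\}$ and let $M$ be the matroid of rank $3$ on $E$ whose bases are exactly the $3$-element subsets $B\subseteq E$ satisfying $|B\cap F|\le 2$ for every $$F\in\{\{a,f,d\},\{e,b,h\},\{a,b,g\},\{e,f,c\},\{e,g,d\},\{a,c,h\},\{b,c,d\},\{f,g,h\}\}.$$ Then there is no connected matroid $M'$ on $E$ whose family of bases $\mathcal{B}(M')$ satisfies $\mathcal{B}(M')\subsetneq\mathcal{B}(M)$.
   Context: $\mathcal{B}(M)$ denotes the family of bases of a matroid $M$. (The eight listed sets pairwise meet in at most one element, so the described family is indeed the base family of a simple connected rank-$3$ matroid.) *)

theory Defs
  imports Main
begin

text \<open>Finite matroids, presented by ground set and family of bases.\<close>

locale matroid =
  fixes E :: "'v set" and \<B> :: "'v set set"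
  assumes finite_ground: "finite E"
    and bases_subset: "B \<in> \<B> \<Longrightarrow> B \<subseteq> E"
    and bases_nonempty: "\<B> \<noteq> {}"
    and basis_exchange: "\<lbrakk>B1 \<in> \<B>; B2 \<in> \<B>; x \<in> B1 - B2\<rbrakk>
      \<Longrightarrow> \<exists>y \<in> B2 - B1. insert y (B1 - {x}) \<in> \<B>"
begin

definition indep :: "'v set \<Rightarrow> bool" where
  "indep X \<longleftrightarrow> (\<exists>B\<in>\<B>. X \<subseteq> B)"

definition circuit :: "'v set \<Rightarrow> bool" where
  "circuit C \<longleftrightarrow> C \<subseteq> E \<and> \<not> indep C \<and> (\<forall>X. X \<subset> C \<longrightarrow> indep X)"

definition connected :: "bool" where
  "connected \<longleftrightarrow> (\<forall>x\<in>E. \<forall>y\<in>E. x \<noteq> y \<longrightarrow> (\<exists>C. circuit C \<and> x \<in> C \<and> y \<in> C))"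

end

text \<open>
  Removing from the 3-subsets of a finite set those contained in a member of a family of 3-subsets
  that pairwise meet in at most one element leaves the bases of a matroid, as soon as at least one
  3-subset remains. In particular, the family of bases prescribed for eight elements below really
  is the family of bases of a matroid.
\<close>

lemma matroid_avoiding:
  assumes fin: "finite E"
    and F3: "\<And>F. F \<in> \<F> \<Longrightarrow> card F = 3"
    and meet: "\<And>F G. \<lbrakk>F \<in> \<F>; G \<in> \<F>; F \<noteq> G\<rbrakk> \<Longrightarrow> card (F \<inter> G) \<le> 1"
    and ne: "{B. B \<subseteq> E \<and> card B = 3 \<and> (\<forall>F\<in>\<F>. card (B \<inter> F) \<le> 2)} \<noteq> {}"
  shows "matroid E {B. B \<subseteq> E \<and> card B = 3 \<and> (\<forall>F\<in>\<F>. card (B \<inter> F) \<le> 2)}"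
    (is "matroid E ?\<B>")
proof
  show "finite E" by (fact fin)
  show "B \<subseteq> E" if "B \<in> ?\<B>" for B using that by simp
  show "?\<B> \<noteq> {}" by (fact ne)
  fix B1 B2 x
  assume B1: "B1 \<in> ?\<B>" and B2: "B2 \<in> ?\<B>" and x: "x \<in> B1 - B2"
  have finB: "finite B1" "finite B2" using B1 B2 fin finite_subset by auto
  define P where "P = B1 - {x}"
  have P2: "card P = 2" and finP: "finite P" using B1 x finB by (auto simp: P_def)
  show "\<exists>y\<in>B2 - B1. insert y (B1 - {x}) \<in> ?\<B>"
  proof (rule ccontr)
    assume no: "\<not> ?thesis"
    have bad: "\<exists>F\<in>\<F>. insert y P \<subseteq> F" if y: "y \<in> B2 - B1" for y
    proof -
      have c3: "card (insert y P) = 3" using P2 finP y by (auto simp: P_def)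
      have "insert y P \<subseteq> E" using B1 B2 y by (auto simp: P_def)
      with c3 y no obtain F where F: "F \<in> \<F>" "\<not> card (insert y P \<inter> F) \<le> 2"
        unfolding P_def by auto
      have "insert y P \<inter> F = insert y P"
        by (rule card_seteq) (use finP c3 F(2) in auto)
      then show ?thesis using F(1) by blast
    qed
    have uniq: "F = G" if "F \<in> \<F>" "G \<in> \<F>" "P \<subseteq> F" "P \<subseteq> G" for F G
    proof (rule ccontr)
      assume "F \<noteq> G"
      then have "card (F \<inter> G) \<le> 1" using meet that by blast
      moreover have "finite F" using F3[OF that(1)] card.infinite by fastforce
      then have "card P \<le> card (F \<inter> G)" using that by (intro card_mono) auto
      ultimately show False using P2 by simp
    qed
    have "B2 - B1 \<noteq> {}"
    proof
      assume "B2 - B1 = {}"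
      then have "B2 = B1" using B1 B2 finB by (intro card_seteq) auto
      then show False using x by simp
    qed
    then obtain F where F: "F \<in> \<F>" "P \<subseteq> F" using bad by blast
    have "B2 - B1 \<subseteq> F"
    proof
      fix y assume "y \<in> B2 - B1"
      then obtain G where "G \<in> \<F>" "insert y P \<subseteq> G" using bad by blast
      then show "y \<in> F" using uniq[of F G] F by auto
    qed
    then have "B2 \<subseteq> F" using F(2) x by (auto simp: P_def)
    then have "B2 \<inter> F = B2" by blast
    then have "\<not> card (B2 \<inter> F) \<le> 2" using B2 by simp
    then show False using B2 F(1) by blast
  qed
qed

lemma matroid_eight_lines:
  assumes dist: "distinct [a, b, c, d, e, f, g, h]"
  shows "matroid {a, b, c, d, e, f, g, h}
    {B. B \<subseteq> {a, b, c, d, e, f, g, h} \<and> card B = 3 \<and>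
       (\<forall>F \<in> {{a, f, d}, {e, b, h}, {a, b, g}, {e, f, c},
              {e, g, d}, {a, c, h}, {b, c, d}, {f, g, h}}. card (B \<inter> F) \<le> 2)}"
proof -
  have ne: "a \<noteq> b" "a \<noteq> c" "a \<noteq> d" "a \<noteq> e" "a \<noteq> f" "a \<noteq> g" "a \<noteq> h"
    "b \<noteq> c" "b \<noteq> d" "b \<noteq> e" "b \<noteq> f" "b \<noteq> g" "b \<noteq> h"
    "c \<noteq> d" "c \<noteq> e" "c \<noteq> f" "c \<noteq> g" "c \<noteq> h"
    "d \<noteq> e" "d \<noteq> f" "d \<noteq> g" "d \<noteq> h"
    "e \<noteq> f" "e \<noteq> g" "e \<noteq> h" "f \<noteq> g" "f \<noteq> h" "g \<noteq> h"
    using dist by simp_all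
  note ineqs = ne ne[symmetric]
  let ?L = "{{a, f, d}, {e, b, h}, {a, b, g}, {e, f, c},
             {e, g, d}, {a, c, h}, {b, c, d}, {f, g, h}}"
  have three: "\<forall>F\<in>?L. card F = 3"
    by (simp add: ineqs)
  have meet: "F = G \<or> card (F \<inter> G) \<le> 1" if "F \<in> ?L" "G \<in> ?L" for F G
    using that by (elim insertE emptyE; hypsubst; simp add: ineqs)
  have abc: "{a, b, c} \<subseteq> {a, b, c, d, e, f, g, h} \<and> card {a, b, c} = 3 \<and>
      (\<forall>F\<in>?L. card ({a, b, c} \<inter> F) \<le> 2)"
    by (simp add: ineqs)
  show ?thesis
  proof (rule matroid_avoiding)
    show "finite {a, b, c, d, e, f, g, h}" by simp
    show "card F = 3" if "F \<in> ?L" for F using bspec[OF three that] .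
    show "card (F \<inter> G) \<le> 1" if "F \<in> ?L" "G \<in> ?L" "F \<noteq> G" for F G
      using meet[OF that(1,2)] that(3) by (simp only: simp_thms)
    show "{B. B \<subseteq> {a, b, c, d, e, f, g, h} \<and> card B = 3 \<and> (\<forall>F\<in>?L. card (B \<inter> F) \<le> 2)} \<noteq> {}"
      (is "?B \<noteq> {}")
    proof
      assume "?B = {}"
      then have "{a, b, c} \<notin> ?B" by (rule equals0D)
      moreover have "{a, b, c} \<in> ?B" by (rule CollectI) (fact abc)
      ultimately show False by (rule notE)
    qed
  qed
qed

end

theory Submission
  imports Defs
begin

text \<open>The eight lines form the Moebius--Kantor configuration, the affine plane of order 3 minus a
  point, whose automorphism group acts transitively on ordered pairs of collinear points. Let \<open>M'\<close> be
  a connected matroid of rank 3 in which the eight lines remain dependent. If two points were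
  parallel in \<open>M'\<close>, then following the lines through their parallel class \<open>P\<close> would put nearly all
  other points on one hyperplane, the remaining ones being parallel to each other; this disconnects
  \<open>M'\<close>. So \<open>M'\<close> is simple. If some further triple were dependent, its closure would contain third
  points of lines again and again until it is all of \<open>E\<close>, contradicting rank 3. Hence \<open>M'\<close> has the
  same bases as \<open>M\<close>.\<close>

section \<open>Parallel points, spans and separation in rank three\<close>

locale connected_rank3_matroid = matroid E \<B> for E :: "'v set" and \<B> +
  assumes rank3: "B \<in> \<B> \<Longrightarrow> card B = 3"
    and conn: "connected"
    and nontrivial: "\<exists>x\<in>E. \<exists>y\<in>E. x \<noteq> y"
begin

text \<open>Quantifying over triples makes every point parallel to itself. Points outside
  \<open>E\<close> are parallel to everything, so transitivity needs its middle point in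
  \<open>E\<close>.\<close>

definition parallel :: "'v \<Rightarrow> 'v \<Rightarrow> bool" where
  "parallel x y \<longleftrightarrow> (\<forall>z. {x, y, z} \<notin> \<B>)"

lemma degenerate_not_basis [simp]: "{x, y} \<notin> \<B>" "{x, y, x} \<notin> \<B>"
proof -
  have "card {x, y} \<noteq> 3" "card {x, y, x} \<noteq> 3" by (simp_all add: card_insert_if)
  then show "{x, y} \<notin> \<B>" "{x, y, x} \<notin> \<B>" using rank3 by blast+
qed

lemma parallel_refl [simp]: "parallel x x"
  by (simp add: parallel_def)

lemma parallel_sym: "parallel x y \<Longrightarrow> parallel y x"
  by (simp add: parallel_def insert_commute)

lemma parallel_not_basis:
  assumes "parallel x y"
  shows "{x, y, z} \<notin> \<B>" "{x, z, y} \<notin> \<B>"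
proof -
  show "{x, y, z} \<notin> \<B>" using assms by (simp add: parallel_def)
  moreover have "{x, z, y} = {x, y, z}" by blast
  ultimately show "{x, z, y} \<notin> \<B>" by simp
qed

lemma basis_triple:
  assumes "B \<in> \<B>"
  obtains x y z where "B = {x, y, z}" "x \<noteq> y" "x \<noteq> z" "y \<noteq> z"
  using rank3[OF assms] by (auto simp: card_3_iff)

lemma basis_distinct:
  assumes "{x, y, z} \<in> \<B>"
  shows "x \<noteq> y" "x \<noteq> z" "y \<noteq> z"
  using rank3[OF assms] by (auto simp: card_insert_if split: if_splits)

lemma circuit_proper_subset:
  assumes "circuit C" "X \<subset> C"
  obtains B where "B \<in> \<B>" "X \<subseteq> B"
proof -
  have "indep X" using assms unfolding circuit_def by simp
  then show ?thesis using that unfolding indep_def by fast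
qed

lemma extend_pair:
  assumes B: "{x, y, u} \<in> \<B>" and "B' \<in> \<B>"
  obtains p where "p \<in> B'" "{x, y, p} \<in> \<B>"
proof (cases "u \<in> B'")
  case True
  then show ?thesis using B that by blast
next
  case False
  then obtain p where "p \<in> B'" "insert p ({x, y, u} - {u}) \<in> \<B>"
    using basis_exchange[OF assms, of u] by auto
  moreover have "{x, y, u} - {u} = {x, y}"
    using basis_distinct[OF B] by auto
  ultimately show ?thesis using that by (simp add: insert_commute)
qed

lemma nonloop:
  assumes "x \<in> E"
  obtains s t where "{x, s, t} \<in> \<B>"
proof -
  obtain y where "y \<in> E" "x \<noteq> y" using nontrivial by metis
  then obtain C where C: "circuit C" "x \<in> C" "y \<in> C"
    using conn assms by (auto simp: connected_def)
  then have "{x} \<subset> C" using \<open>x \<noteq> y\<close> by auto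
  then obtain B where B: "B \<in> \<B>" "x \<in> B"
    by (rule circuit_proper_subset[OF C(1)]) simp
  from B(1) obtain p q r where pqr: "B = {p, q, r}" by (rule basis_triple)
  then have alt: "B = {q, p, r}" "B = {r, p, q}" by auto
  have "x = p \<or> x = q \<or> x = r" using B(2) pqr by simp
  then show ?thesis using pqr alt B(1) that by metis
qed

lemma extend_point:
  assumes "x \<in> E" "B \<in> \<B>"
  obtains p q where "p \<in> B" "q \<in> B" "p \<noteq> q" "{x, p, q} \<in> \<B>"
proof -
  obtain s t where st: "{x, s, t} \<in> \<B>" using nonloop[OF assms(1)] .
  obtain p where p: "p \<in> B" "{x, s, p} \<in> \<B>"
    using extend_pair[OF st assms(2)] .
  then have xps: "{x, p, s} \<in> \<B>" by (simp add: insert_commute)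
  obtain q where q: "q \<in> B" "{x, p, q} \<in> \<B>"
    using extend_pair[OF xps assms(2)] .
  show ?thesis using p(1) q that basis_distinct(3)[OF q(2)] by blast
qed

text \<open>Two points of the basis \<open>{y, z, w}\<close> would extend \<open>x\<close> to a
  basis; parallelism rules out \<open>y\<close>, leaving \<open>z\<close> and
  \<open>w\<close>.\<close>

lemma parallel_subst:
  assumes "x \<in> E" "parallel x y" "{x, z, w} \<notin> \<B>"
  shows "{y, z, w} \<notin> \<B>"
proof
  assume B: "{y, z, w} \<in> \<B>"
  obtain p q where "p \<in> {y, z, w}" "q \<in> {y, z, w}" "p \<noteq> q" "{x, p, q} \<in> \<B>"
    using extend_point[OF assms(1) B] .
  then show False
    using assms(2,3) by (auto simp: parallel_def insert_commute)
qed

lemma parallel_subst':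
  assumes "y \<in> E" "parallel x y" "{y, z, w} \<notin> \<B>"
  shows "{x, z, w} \<notin> \<B>"
  using parallel_subst[OF assms(1) parallel_sym[OF assms(2)] assms(3)] .

lemma parallel_trans:
  assumes "y \<in> E" "parallel x y" "parallel y z"
  shows "parallel x z"
  using parallel_subst[OF assms(1), of x z] assms(2,3)
  by (auto simp: parallel_def insert_commute)

text \<open>If \<open>{x, z, v}\<close> were a basis, one of its points would extend the independent
  pair \<open>x\<close>, \<open>w\<close> to a basis; none of the three does.\<close>

lemma not_basis_trans:
  assumes "{x, z, w} \<notin> \<B>" "{x, w, v} \<notin> \<B>" "\<not> parallel x w"
  shows "{x, z, v} \<notin> \<B>"
proof
  assume B: "{x, z, v} \<in> \<B>"
  obtain u where u: "{x, w, u} \<in> \<B>" using assms(3) by (auto simp: parallel_def)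
  obtain p where p: "p \<in> {x, z, v}" "{x, w, p} \<in> \<B>"
    using extend_pair[OF u B] .
  show False using p assms(1,2) basis_distinct[OF p(2)] by (auto simp: insert_commute)
qed

lemma not_basis_span:
  assumes "\<not> parallel x y" "\<And>p. p \<in> T \<Longrightarrow> {x, y, p} \<notin> \<B>"
  shows "T \<notin> \<B>"
proof
  assume T: "T \<in> \<B>"
  obtain u where u: "{x, y, u} \<in> \<B>" using assms(1) by (auto simp: parallel_def)
  obtain p where "p \<in> T" "{x, y, p} \<in> \<B>" using extend_pair[OF u T] .
  then show False using assms(2) by blast
qed

text \<open>The points \<open>p\<close> and \<open>q\<close> span the same flat as \<open>x\<close>
  and \<open>y\<close>, so no point of \<open>{x, y, r}\<close> extends \<open>p\<close>,
  \<open>q\<close> to a basis.\<close>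

lemma span_closed:
  assumes "\<not> parallel x y" "\<not> parallel p q"
    and "{x, y, p} \<notin> \<B>" "{x, y, q} \<notin> \<B>" "{p, q, r} \<notin> \<B>"
  shows "{x, y, r} \<notin> \<B>"
proof (rule not_basis_span[OF assms(2)])
  fix t assume "t \<in> {x, y, r}"
  moreover have "{p, q, s} \<notin> \<B>" if "s \<in> {x, y}" for s
    by (rule not_basis_span[OF assms(1)]) (use assms(3,4) that in auto)
  ultimately show "{p, q, t} \<notin> \<B>" using assms(5) by auto
qed

text \<open>A circuit \<open>C\<close> through \<open>x \<in> S\<close> and \<open>y \<notin> S\<close> would meet \<open>S\<close> in \<open>x\<close> only. Every basis containing
  \<open>C - {x}\<close> meets \<open>S\<close> in one point, which can be replaced by the parallel point \<open>x\<close>.\<close>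

lemma no_separator:
  assumes S: "S \<subseteq> E" "\<And>x y. x \<in> S \<Longrightarrow> y \<in> S \<Longrightarrow> parallel x y"
    and rest: "\<And>B. B \<in> \<B> \<Longrightarrow> \<not> B \<subseteq> E - S"
  shows False
proof -
  have meet: "\<exists>s p q. s \<in> S \<and> B = {s, p, q} \<and> p \<notin> S \<and> q \<notin> S" if B: "B \<in> \<B>" for B
  proof -
    obtain s where s: "s \<in> S" "s \<in> B" using rest B bases_subset by blast
    obtain x y z where "B = {x, y, z}" using B by (rule basis_triple)
    then obtain p q where pq: "B = {s, p, q}" using s by (auto simp: insert_commute)
    have "p \<notin> S" "q \<notin> S"
      using S(2)[OF s(1)] parallel_not_basis[of s] B pq by blast+
    then show ?thesis using pq s by blast
  qed
  obtain B0 where "B0 \<in> \<B>" using bases_nonempty by blast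
  then obtain x y where xy: "x \<in> S" "y \<in> E - S" using meet bases_subset by fastforce
  then obtain C where C: "circuit C" "x \<in> C" "y \<in> C"
    using conn S(1) unfolding connected_def by (metis Diff_iff subsetD)
  have single: "C \<inter> S = {x}"
  proof (rule ccontr)
    assume "C \<inter> S \<noteq> {x}"
    then obtain x' where x': "x' \<in> C" "x' \<in> S" "x' \<noteq> x" using C xy by blast
    then have "{x, x'} \<subset> C" using C xy by auto
    then obtain B where B: "B \<in> \<B>" "{x, x'} \<subseteq> B"
      by (rule circuit_proper_subset[OF C(1)])
    then show False using meet[OF B(1)] xy(1) x' by blast
  qed
  have "C - {x} \<subset> C" using C by auto
  then obtain B where B: "B \<in> \<B>" "C - {x} \<subseteq> B"
    by (rule circuit_proper_subset[OF C(1)])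
  then obtain s p q where spq: "s \<in> S" "B = {s, p, q}" using meet by blast
  have "{x, p, q} \<in> \<B>"
    using parallel_subst[of x s p q] S xy spq B(1) by blast
  moreover have "C \<subseteq> {x, p, q}" using B(2) spq single by blast
  ultimately show False using C(1) by (auto simp: circuit_def indep_def)
qed

text \<open>All points but \<open>s\<close> lie in a flat of rank two, so every basis contains
  \<open>s\<close> and \<open>{s}\<close> separates.\<close>

lemma no_coloop:
  assumes "s \<in> E" "\<not> parallel x y" "\<And>z. z \<in> E - {s} \<Longrightarrow> {x, y, z} \<notin> \<B>"
  shows False
proof (rule no_separator[of "{s}"])
  fix B assume "B \<in> \<B>"
  then show "\<not> B \<subseteq> E - {s}"
    using not_basis_span[OF assms(2), of B] assms(3) by blast
qed (use assms(1) in auto)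

lemma rank_not_two:
  assumes "\<not> parallel x y" "\<And>z. z \<in> E \<Longrightarrow> {x, y, z} \<notin> \<B>"
  shows False
proof (rule no_separator[of "{}"])
  fix B assume "B \<in> \<B>"
  then show "\<not> B \<subseteq> E - {}"
    using not_basis_span[OF assms(1), of B] assms(2) by blast
qed auto

end

section \<open>The Moebius-Kantor configuration and its symmetries\<close>

text \<open>The configuration is the affine plane over the field with three elements without its origin:
  for independent vectors \<open>a\<close>, \<open>b\<close> one has \<open>c = a + b\<close>, \<open>d = b - a\<close>, \<open>e = -a\<close>, \<open>f = -b\<close>,
  \<open>g = -a - b\<close>, \<open>h = a - b\<close>, and three vectors form a line iff they sum to zero.\<close>

definition moebius_kantor ::
  "'v set \<Rightarrow> 'v set set \<Rightarrow> 'v \<Rightarrow> 'v \<Rightarrow> 'v \<Rightarrow> 'v \<Rightarrow> 'v \<Rightarrow> 'v \<Rightarrow> 'v \<Rightarrow> 'v \<Rightarrow> bool" where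
  "moebius_kantor E L a b c d e f g h \<longleftrightarrow>
     distinct [a, b, c, d, e, f, g, h] \<and> E = {a, b, c, d, e, f, g, h} \<and>
     L = {{a, f, d}, {e, b, h}, {a, b, g}, {e, f, c}, {e, g, d}, {a, c, h}, {b, c, d}, {f, g, h}}"

text \<open>A Singer cycle, and generators of the stabiliser of \<open>a\<close> in the linear group.\<close>

lemma moebius_kantor_cycle:
  "moebius_kantor E L a b c d e f g h \<Longrightarrow> moebius_kantor E L b h a c f d e g"
  unfolding moebius_kantor_def by (simp add: insert_commute eq_commute)

lemma moebius_kantor_rotate:
  "moebius_kantor E L a b c d e f g h \<Longrightarrow> moebius_kantor E L a c d b e g h f"
  unfolding moebius_kantor_def by (simp add: insert_commute eq_commute)

lemma moebius_kantor_reflect: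
  "moebius_kantor E L a b c d e f g h \<Longrightarrow> moebius_kantor E L a f h g e b d c"
  unfolding moebius_kantor_def by (simp add: insert_commute eq_commute)

text \<open>The cycle permutes all eight points cyclically, so its powers put any point in the role
  of \<open>a\<close>.\<close>

lemma moebius_kantor_point:
  assumes "moebius_kantor E L a b c d e f g h" "x \<in> E"
  obtains b' c' d' e' f' g' h' where "moebius_kantor E L x b' c' d' e' f' g' h'"
proof -
  note 0 = assms(1)
  note 1 = moebius_kantor_cycle[OF 0]
  note 2 = moebius_kantor_cycle[OF 1]
  note 3 = moebius_kantor_cycle[OF 2]
  note 4 = moebius_kantor_cycle[OF 3]
  note 5 = moebius_kantor_cycle[OF 4]
  note 6 = moebius_kantor_cycle[OF 5]
  note 7 = moebius_kantor_cycle[OF 6]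
  have "x \<in> {a, b, c, d, e, f, g, h}" using assms by (simp add: moebius_kantor_def)
  then show ?thesis
    using 0 1 2 3 4 5 6 7 that by blast
qed

text \<open>Both generators fix \<open>e\<close>, the antipode of \<open>a\<close> and the only
  point not collinear with it; together they permute the other six points transitively.\<close>

lemma moebius_kantor_flag:
  assumes "moebius_kantor E L a b c d e f g h" "y \<in> E" "y \<noteq> a" "y \<noteq> e"
  obtains c' d' f' g' h' where "moebius_kantor E L a y c' d' e f' g' h'"
proof -
  note 0 = assms(1)
  note 1 = moebius_kantor_rotate[OF 0]
  note 2 = moebius_kantor_rotate[OF 1]
  note 3 = moebius_kantor_reflect[OF 0]
  note 4 = moebius_kantor_rotate[OF 3]
  note 5 = moebius_kantor_rotate[OF 4]
  have "y \<in> {b, c, d, f, g, h}" using assms by (auto simp: moebius_kantor_def)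
  then show ?thesis
    using 0 1 2 3 4 5 that by blast
qed

section \<open>Connected matroids in which the eight lines stay dependent\<close>

locale connected_below_moebius_kantor = connected_rank3_matroid E \<B>
  for E :: "'v set" and \<B> +
  fixes L :: "'v set set"
  assumes line_not_basis: "F \<in> L \<Longrightarrow> F \<notin> \<B>"
begin

lemma moebius_kantor_lines:
  assumes "moebius_kantor E L a b c d e f g h"
  shows "{a, f, d} \<notin> \<B>" "{b, e, h} \<notin> \<B>" "{a, b, g} \<notin> \<B>" "{e, f, c} \<notin> \<B>"
    "{d, e, g} \<notin> \<B>" "{a, c, h} \<notin> \<B>" "{b, c, d} \<notin> \<B>" "{f, g, h} \<notin> \<B>"
proof -
  have "\<forall>F\<in>L. F \<notin> \<B>" using line_not_basis by blast
  then show "{a, f, d} \<notin> \<B>" "{b, e, h} \<notin> \<B>" "{a, b, g} \<notin> \<B>" "{e, f, c} \<notin> \<B>"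
    "{d, e, g} \<notin> \<B>" "{a, c, h} \<notin> \<B>" "{b, c, d} \<notin> \<B>" "{f, g, h} \<notin> \<B>"
    using assms by (simp_all add: moebius_kantor_def insert_commute)
qed

text \<open>The complement of \<open>S\<close> is too small to contain a basis, so the pairwise
  parallel points of \<open>S\<close> would form a separator.\<close>

lemma line_complement_not_parallel:
  assumes "S \<subseteq> E" "a \<in> E" "{x, y, z} \<notin> \<B>" "E - S \<subseteq> {x, y, z}"
    and par: "\<And>s. s \<in> S \<Longrightarrow> parallel a s"
  shows False
proof (rule no_separator[OF assms(1)])
  show "parallel s t" if "s \<in> S" "t \<in> S" for s t
    using parallel_trans[OF assms(2)] par parallel_sym that by blast
  fix B assume B: "B \<in> \<B>"
  show "\<not> B \<subseteq> E - S"
  proof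
    assume "B \<subseteq> E - S"
    then have sub: "B \<subseteq> {x, y, z}" using assms(4) by blast
    have "card {x, y, z} \<le> card B" using rank3[OF B] by (simp add: card_insert_if)
    then have "B = {x, y, z}" using sub by (intro card_seteq) auto
    then show False using B assms(3) by simp
  qed
qed

text \<open>In vector notation: no three points \<open>a\<close>, \<open>b\<close>, \<open>b - a\<close> are parallel. By symmetry this also
  excludes \<open>c\<close> and \<open>h\<close> from a parallel class containing \<open>a\<close> and \<open>b\<close>.\<close>

lemma not_parallel_triangle:
  assumes mk: "moebius_kantor E L a b c d e f g h"
    and ab: "parallel a b"
  shows "\<not> parallel a d"
proof
  assume ad: "parallel a d"
  have E: "E = {a, b, c, d, e, f, g, h}" using mk by (simp add: moebius_kantor_def)
  note lines = moebius_kantor_lines[OF mk]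
  note subst = parallel_subst'[rotated]
  have ch: "{a, h, c} \<notin> \<B>" using lines by (simp add: insert_commute)
  have eh: "{a, h, e} \<notin> \<B>" using subst[OF ab, of e h] lines E by (simp add: insert_commute)
  have eg: "{a, e, g} \<notin> \<B>" using subst[OF ad] lines E by simp
  then have ge: "{a, g, e} \<notin> \<B>" by (simp add: insert_commute)
  show False
  \<comment> \<open>In each branch either the points parallel to \<open>a\<close> leave only one
    line outside, or a span of rank two misses a single point.\<close>
  proof (cases "parallel a h")
    case True
    have fg: "{a, g, f} \<notin> \<B>" using subst[OF True, of f g] lines E by (simp add: insert_commute)
    show False
    proof (cases "parallel a g")
      case g: True
      show False
        by (rule line_complement_not_parallel[of "{a, b, d, h, g}" a e f c])
          (use E lines ab ad True g in auto)
    next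
      case False
      show False
        by (rule no_coloop[of c a g])
          (use E False fg ge parallel_not_basis ab ad True in auto)
    qed
  next
    case h: False
    show False
    proof (cases "parallel a e")
      case True
      have cf: "{a, c, f} \<notin> \<B>" using subst[OF True, of f c] lines E by (simp add: insert_commute)
      show False
      proof (cases "parallel a c")
        case c: True
        show False
          by (rule line_complement_not_parallel[of "{a, b, d, e, c}" a f g h])
            (use E lines ab ad True c in auto)
      next
        case False
        then have "{a, h, f} \<notin> \<B>" using not_basis_trans ch cf by blast
        then show False
          by (intro no_coloop[of g a h]) (use E h ch eh parallel_not_basis ab ad in auto)
      qed
    next
      case False
      then have "{a, h, g} \<notin> \<B>" using not_basis_trans eh eg by blast
      then show False
        by (intro no_coloop[of f a h]) (use E h ch eh parallel_not_basis ab ad in auto)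
    qed
  qed
qed

text \<open>If \<open>a\<close> and \<open>b\<close> were parallel, \<open>c\<close>,
  \<open>d\<close> and \<open>h\<close> would not be parallel to them, and the lines, with
  \<open>a\<close> in place of \<open>b\<close>, would put all points but \<open>g\<close> in the
  span of \<open>a\<close> and \<open>c\<close>.\<close>

lemma not_parallel_collinear:
  assumes mk: "moebius_kantor E L a b c d e f g h"
  shows "\<not> parallel a b"
proof
  assume ab: "parallel a b"
  have E: "E = {a, b, c, d, e, f, g, h}" using mk by (simp add: moebius_kantor_def)
  have aE: "a \<in> E" by (simp add: E)
  have bE: "b \<in> E" by (simp add: E)
  note lines = moebius_kantor_lines[OF mk]
  note subst = parallel_subst'[OF bE ab]
  note rot = moebius_kantor_rotate[OF mk]
  have c: "\<not> parallel a c" using not_parallel_triangle[OF rot] ab by blast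
  have d: "\<not> parallel a d" using not_parallel_triangle[OF mk ab] .
  \<comment> \<open>The excluded triangle is \<open>b\<close>, \<open>a\<close>,
    \<open>a - b\<close> in vector notation.\<close>
  have "\<not> parallel b h"
    using not_parallel_triangle[OF moebius_kantor_rotate[OF moebius_kantor_cycle[OF mk]]]
      parallel_sym[OF ab] by blast
  then have h: "\<not> parallel a h" using parallel_trans[OF aE] parallel_sym[OF ab] by blast
  have dc: "{a, c, d} \<notin> \<B>" using subst lines by simp
  have df: "{a, d, f} \<notin> \<B>" using lines by (simp add: insert_commute)
  have ch: "{a, c, h} \<notin> \<B>" using lines by simp
  have he: "{a, h, e} \<notin> \<B>" using subst[of e h] lines by (simp add: insert_commute)
  have "{a, c, f} \<notin> \<B>" "{a, c, e} \<notin> \<B>"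
    using not_basis_trans dc df d ch he h by blast+
  then show False
    by (intro no_coloop[of g a c]) (use E c dc ch parallel_not_basis ab in auto)
qed

lemma not_parallel:
  assumes mk: "moebius_kantor E L a b c d e f g h"
    and xy: "x \<in> E" "y \<in> E" "x \<noteq> y"
  shows "\<not> parallel x y"
proof -
  obtain b c d e f g h where mk: "moebius_kantor E L x b c d e f g h"
    using moebius_kantor_point[OF mk xy(1)] .
  have coll: "\<not> parallel x z" if "z \<in> E" "z \<noteq> x" "z \<noteq> e" for z
    using moebius_kantor_flag[OF mk that] not_parallel_collinear by metis
  show ?thesis
  \<comment> \<open>Only the antipode \<open>e\<close> of \<open>x\<close> remains. Replacing
    \<open>e\<close> by \<open>x\<close> in its three lines chains all points into the span of
    \<open>x\<close> and \<open>b\<close>, so the rank would be two.\<close>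
  proof (cases "y = e")
    case True
    have E: "E = {x, b, c, d, e, f, g, h}" and dist: "distinct [x, b, c, d, e, f, g, h]"
      using mk by (simp_all add: moebius_kantor_def)
    have eE: "e \<in> E" by (simp add: E)
    note lines = moebius_kantor_lines[OF mk]
    show ?thesis
    proof
      assume par: "parallel x y"
      note subst = parallel_subst'[OF eE par[unfolded True]]
      have np: "\<not> parallel x b" "\<not> parallel x g" "\<not> parallel x d"
          "\<not> parallel x f" "\<not> parallel x c"
        using coll E dist by auto
      have bg: "{x, b, g} \<notin> \<B>" using lines by simp
      have bh: "{x, b, h} \<notin> \<B>" using subst[of b h] lines by (simp add: insert_commute)
      have gd: "{x, g, d} \<notin> \<B>" using subst[of g d] lines by (simp add: insert_commute)
      have df: "{x, d, f} \<notin> \<B>" using lines by (simp add: insert_commute)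
      have fc: "{x, f, c} \<notin> \<B>" using subst lines by simp
      have bd: "{x, b, d} \<notin> \<B>" using not_basis_trans[OF bg gd np(2)] .
      have bf: "{x, b, f} \<notin> \<B>" using not_basis_trans[OF bd df np(3)] .
      have bc: "{x, b, c} \<notin> \<B>" using not_basis_trans[OF bf fc np(4)] .
      show False
        by (rule rank_not_two[OF np(1)])
          (use E bg bh bd bf bc parallel_not_basis par True in auto)
    qed
  next
    case False
    then show ?thesis using coll xy by blast
  qed
qed

lemma collinear_imp_line:
  assumes mk: "moebius_kantor E L a b c d e f g h"
    and xyz: "x \<in> E" "y \<in> E" "z \<in> E" "x \<noteq> y" "x \<noteq> z" "y \<noteq> z"
    and col: "{x, y, z} \<notin> \<B>"
  shows "{x, y, z} \<in> L"
proof -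
  \<comment> \<open>First the case where \<open>x\<close> and \<open>y\<close> lie on a common line,
    with third point \<open>g\<close>.\<close>
  have main: "{x, y, z} \<in> L"
    if mk: "moebius_kantor E L x y c d e f g h" and z: "z \<in> E" "z \<noteq> x" "z \<noteq> y"
      and col: "{x, y, z} \<notin> \<B>" for x y z c d e f g h
  proof (rule ccontr)
    assume no: "{x, y, z} \<notin> L"
    have E: "E = {x, y, c, d, e, f, g, h}" and dist: "distinct [x, y, c, d, e, f, g, h]"
      using mk by (simp_all add: moebius_kantor_def)
    have L_def: "L = {{x, f, d}, {e, y, h}, {x, y, g}, {e, f, c}, {e, g, d}, {x, c, h},
        {y, c, d}, {f, g, h}}" using mk by (simp add: moebius_kantor_def)
    have L: "{x, y, g} \<in> L" by (simp add: L_def)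
    have L_sub: "\<Union> L \<subseteq> E" unfolding L_def E by simp
    \<comment> \<open>The flat spanned by \<open>x\<close> and \<open>y\<close>, together with
      everything outside \<open>E\<close>.\<close>
    define H where "H = {z. {x, y, z} \<notin> \<B>}"
    have np: "\<not> parallel p q" if "p \<in> E" "q \<in> E" "p \<noteq> q" for p q
      using not_parallel[OF mk that] .
    have xy: "\<not> parallel x y" using np E dist by auto
    have H: "x \<in> H" "y \<in> H" "z \<in> H"
      using col by (auto simp: H_def)
    have close: "r \<in> H" if "{p, q, r} \<notin> \<B>" "p \<in> H" "q \<in> H" "p \<in> E" "q \<in> E" "p \<noteq> q" for p q r
      using span_closed[OF xy np[OF that(4-6)] _ _ that(1)] that(2,3) by (simp add: H_def)
    note lines = moebius_kantor_lines[OF mk]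
    have g: "g \<in> H" using lines by (auto simp: H_def)
    have "z \<in> {c, d, e, f, h}" using z E no L by auto
    moreover have third: "r \<in> H" if "{p, q, r} \<in> L" "p \<in> H" "q \<in> H" "p \<noteq> q" for p q r
      using close[of p q r] line_not_basis[OF that(1)] that L_sub by blast
    \<comment> \<open>Each candidate for \<open>z\<close> leads to \<open>c\<close>:
      \<open>e\<close> by way of \<open>h\<close>, and \<open>f\<close> by way of
      \<open>d\<close>.\<close>
    have "h \<in> H" if "e \<in> H"
      using third[of y e h] that H dist by (simp add: L_def insert_commute)
    moreover have "d \<in> H" if "f \<in> H"
      using third[of x f d] that H dist by (simp add: L_def insert_commute)
    moreover have "c \<in> H" if "h \<in> H"
      using third[of x h c] that H dist by (simp add: L_def insert_commute)
    moreover have "c \<in> H" if "d \<in> H"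
      using third[of y d c] that H dist by (simp add: L_def insert_commute)
    ultimately have c: "c \<in> H" using H(3) by blast
    have h: "h \<in> H"
      using third[of x c h] H c dist by (simp add: L_def insert_commute)
    have d: "d \<in> H"
      using third[of y c d] H c dist by (simp add: L_def insert_commute)
    have f: "f \<in> H"
      using third[of g h f] g h dist by (simp add: L_def insert_commute)
    have "e \<in> H"
      using third[of c f e] f c dist by (simp add: L_def insert_commute)
    then have "E \<subseteq> H" using H g c h d f E by blast
    then show False using rank_not_two[OF xy] by (auto simp: H_def)
  qed
  obtain b c d e f g h where mk: "moebius_kantor E L x b c d e f g h"
    using moebius_kantor_point[OF mk xyz(1)] .
  show ?thesis
  proof (cases "y = e")
    case False
    then show ?thesis
      using moebius_kantor_flag[OF mk xyz(2)] main xyz col by metis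
  next
    case True
    \<comment> \<open>Here \<open>y\<close> is the antipode of \<open>x\<close>, so \<open>z\<close>
      is collinear with \<open>x\<close> and takes the role of \<open>y\<close>.\<close>
    have comm: "{x, z, y} = {x, y, z}" by blast
    obtain c' d' f' g' h' where "moebius_kantor E L x z c' d' e f' g' h'"
      using moebius_kantor_flag[OF mk xyz(3)] True xyz by metis
    then have "{x, z, y} \<in> L" by (rule main) (use xyz col comm in auto)
    then show ?thesis by (simp only: comm)
  qed
qed

end

theorem theorem5p5:
  fixes a b c d e f g h :: 'v
    and E :: "'v set" and \<B>M :: "'v set set"
  assumes "distinct [a, b, c, d, e, f, g, h]"
    and "E = {a, b, c, d, e, f, g, h}"
    and "matroid E \<B>M"
    and "\<B>M = {B. B \<subseteq> E \<and> card B = 3 \<and>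
           (\<forall>F \<in> {{a, f, d}, {e, b, h}, {a, b, g}, {e, f, c},
                  {e, g, d}, {a, c, h}, {b, c, d}, {f, g, h}}. card (B \<inter> F) \<le> 2)}"
  shows "\<not> (\<exists>\<B>'. matroid E \<B>' \<and> matroid.connected E \<B>' \<and> \<B>' \<subset> \<B>M)"
proof
  define L where "L = {{a, f, d}, {e, b, h}, {a, b, g}, {e, f, c},
    {e, g, d}, {a, c, h}, {b, c, d}, {f, g, h}}"
  have M: "\<B>M = {B. B \<subseteq> E \<and> card B = 3 \<and> (\<forall>F\<in>L. card (B \<inter> F) \<le> 2)}"
    unfolding assms(4) L_def ..
  have mk: "moebius_kantor E L a b c d e f g h"
    using assms(1,2) by (simp add: moebius_kantor_def L_def)
  have avoid: "F \<notin> \<B>M" if "F \<in> L" for F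
  proof
    assume "F \<in> \<B>M"
    then have "card F = 3" "card (F \<inter> F) \<le> 2" using that by (auto simp only: M)
    then show False by simp
  qed
  assume "\<exists>\<B>'. matroid E \<B>' \<and> matroid.connected E \<B>' \<and> \<B>' \<subset> \<B>M"
  then obtain \<B>' where B': "matroid E \<B>'" "matroid.connected E \<B>'" "\<B>' \<subset> \<B>M" by blast
  have ab: "a \<in> E" "b \<in> E" "a \<noteq> b" using assms(1,2) by auto
  interpret connected_below_moebius_kantor E \<B>' L
  proof (intro connected_below_moebius_kantor.intro connected_rank3_matroid.intro
      connected_rank3_matroid_axioms.intro connected_below_moebius_kantor_axioms.intro)
    show "card B = 3" if "B \<in> \<B>'" for B using that B'(3) M by blast
    show "\<exists>x\<in>E. \<exists>y\<in>E. x \<noteq> y" using ab by blast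
    show "F \<notin> \<B>'" if "F \<in> L" for F using that avoid B'(3) by blast
  qed (use B' in auto)
  \<comment> \<open>A basis missing from the smaller family is dependent there, hence one of the
    lines, and no line is in \<open>\<B>M\<close>.\<close>
  obtain T where T: "T \<in> \<B>M" "T \<notin> \<B>'" using B'(3) by blast
  then have "card T = 3" "T \<subseteq> E" by (auto simp: M)
  then obtain x y z where "T = {x, y, z}" "x \<noteq> y" "x \<noteq> z" "y \<noteq> z" "x \<in> E" "y \<in> E" "z \<in> E"
    by (auto simp: card_3_iff)
  then have "T \<in> L" using collinear_imp_line[OF mk] T(2) by blast
  then show False using avoid T(1) by blast
qed

end
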